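(* Let $(X,\mu)$ be a non-atomic probability space, let $k>1$ be an integer, and let $\mathcal{T}$ be a $k$-homogeneous tree on $X$. Let $\phi:X\to[0,\infty)$ be a $\mu$-integrable function such that, for some fixed constants $p>1$ and $c\ge 1$, $$\frac{1}{\mu(I)}\int_I\phi^p\,d\mu\le c\left(\frac{1}{\mu(I)}\int_I\phi\,d\mu\right)^p\qquad\text{for every } I\in\mathcal{T}.$$ Let $p_0>p$ be defined as the root of the equation $$\frac{p_0-p}{p_0}\left(\frac{p_0}{p_0-1}\right)^p(kc-k+1)=1.$$ Then $\phi\in L^q(X,\mu)$ for every $q\in[p,p_0)$.
   Context: A set $\mathcal{T}$ of measurable subsets of $X$ is a $k$-homogeneous tree on $X$ if: (i) $X\in\mathcal{T}$; (ii) to every $I\in\mathcal{T}$ there corresponds a subset $C(I)\subseteq\mathcal{T}$ consisting of $k$ subsets of $I$ such that (a) the elements of $C(I)$ are pairwise disjoint, (b) $I=\bigcup C(I)$, and (c) $\mu(J)=\frac1k\mu(I)$ for every $J\in C(I)$. (Example: $X=[0,1]^n$ with Lebesgue measure and $\mathcal{T}$ the set of all dyadic subcubes, with $k=2^n$.)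
   Formalization: The formal theorem additionally assumes that the tree differentiates L^1(X,μ) (averages over shrinking tree sets containing x converge to f(x) a.e.); without it the claim fails, e.g. for strips in the unit square and φ depending only on the other coordinate. *)

theory Defs
  imports "HOL-Probability.Probability"
begin

definition non_atomic :: "'a measure \<Rightarrow> bool" where
  "non_atomic M \<longleftrightarrow>
     (\<forall>A\<in>sets M. 0 < emeasure M A \<longrightarrow>
        (\<exists>B\<in>sets M. B \<subseteq> A \<and> 0 < emeasure M B \<and> emeasure M B < emeasure M A))"

text \<open>
  The children family \<open>C(I)\<close> is existentially quantified for each member of the tree. For
  \<open>k > 0\<close> the equation \<open>card C = k\<close> forces it to be finite. No condition is imposed here on
  how finely the tree resolves the space; see \<open>differentiates_L1\<close>.
\<close>

definition homogeneous_tree :: "nat \<Rightarrow> 'a measure \<Rightarrow> 'a set set \<Rightarrow> bool" where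
  "homogeneous_tree k M T \<longleftrightarrow>
     T \<subseteq> sets M \<and> space M \<in> T \<and>
     (\<forall>I\<in>T. \<exists>C\<subseteq>T. card C = k \<and> (\<forall>J\<in>C. J \<subseteq> I) \<and> disjoint C \<and> \<Union>C = I \<and>
        (\<forall>J\<in>C. measure M J = 1 / real k * measure M I))"

text \<open>
  The Lebesgue differentiation property of a differentiation basis. It does not follow from
  \<open>homogeneous_tree\<close>: on the unit square, the strips over the dyadic intervals of the first
  coordinate form a 2-homogeneous tree, but averages over them ignore how a function depends on
  the second coordinate.
\<close>

definition differentiates_L1 :: "'a measure \<Rightarrow> 'a set set \<Rightarrow> bool" where
  "differentiates_L1 M T \<longleftrightarrow>
     (\<forall>f :: 'a \<Rightarrow> real. integrable M f \<longrightarrow>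
        (AE x in M. \<forall>I :: nat \<Rightarrow> 'a set.
           (\<forall>n. I n \<in> T \<and> x \<in> I n \<and> 0 < measure M (I n)) \<and>
           (\<lambda>n. measure M (I n)) \<longlonglongrightarrow> 0 \<longrightarrow>
           (\<lambda>n. 1 / measure M (I n) * (LINT y:I n|M. f y)) \<longlonglongrightarrow> f x))"

definition Lp_space :: "real \<Rightarrow> 'a measure \<Rightarrow> ('a \<Rightarrow> real) set" where
  "Lp_space q M = {f \<in> borel_measurable M. integrable M (\<lambda>x. \<bar>f x\<bar> powr q)}"

text \<open>
  The left-hand average is taken in \<open>[0, \<infinity>]\<close>: the Bochner integral of a non-integrable
  function is \<open>0\<close>, which would make the inequality vacuous. In particular, the inequality on a
  set of positive measure includes the finiteness of the integral of \<open>\<phi>\<^sup>p\<close> there. On null sets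
  both sides are \<open>0\<close>.
\<close>

definition reverse_Holder_on ::
    "'a measure \<Rightarrow> 'a set set \<Rightarrow> real \<Rightarrow> real \<Rightarrow> ('a \<Rightarrow> real) \<Rightarrow> bool" where
  "reverse_Holder_on M T p c \<phi> \<longleftrightarrow>
     (\<forall>I\<in>T. (\<integral>\<^sup>+x\<in>I. ennreal (\<phi> x powr p) \<partial>M) / emeasure M I
        \<le> ennreal (c * (1 / measure M I * (LINT x:I|M. \<phi> x)) powr p))"

end

theory Submission
  imports Defs
begin

text \<open>
  The argument avoids rearrangements and works with the maximal function \<open>V\<close> along the tree,
  truncated at a finite depth. Let \<open>S\<^sub>l = {V > l}\<close> and \<open>K = k c - k + 1\<close>. For \<open>l\<close> above the
  average of \<open>\<phi>\<close> over \<open>X\<close>, induction on the depth gives \<open>l \<mu>(S\<^sub>l) \<le> \<integral>\<phi>\<close> and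
  \<open>\<integral>\<phi>\<^sup>p - p l\<^sup>p\<^sup>-\<^sup>1 \<integral>\<phi> + (p - K) l\<^sup>p \<mu>(S\<^sub>l) \<le> 0\<close>, the integrals being over \<open>S\<^sub>l\<close>.
  Multiplying by \<open>l\<^sup>q\<^sup>-\<^sup>2\<close> and \<open>l\<^sup>q\<^sup>-\<^sup>p\<^sup>-\<^sup>1\<close> respectively and integrating over \<open>l\<close> yields linear
  inequalities between the integrals of \<open>\<phi>\<^sup>p V\<^sup>q\<^sup>-\<^sup>p\<close>, \<open>\<phi> V\<^sup>q\<^sup>-\<^sup>1\<close> and \<open>V\<^sup>q\<close>. A suitable
  combination, estimated by the tangent of \<open>u\<^sup>p\<close> at \<open>u = (q - 1) / q\<close> with \<open>u = \<phi> / V\<close>, bounds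
  \<open>\<integral>V\<^sup>q\<close> uniformly in the depth when \<open>(q - p) / q (q / (q - 1))\<^sup>p K < 1\<close>. The left-hand
  side increases with \<open>q\<close> and equals \<open>1\<close> at \<open>p\<^sub>0\<close>. Finally \<open>\<phi> \<le> sup V\<close> almost everywhere by
  differentiation.
\<close>

section \<open>Inequalities for real powers\<close>

text \<open>For positive x and y this is convexity. The endpoint cases are separate;
  \<open>0 powr 0 = 0\<close> makes the case \<open>y = 0\<close> trivial even for
  \<open>p = 1\<close>.\<close>

lemma powr_ge_tangent:
  fixes x y p :: real
  assumes "0 \<le> x" "0 \<le> y" "1 \<le> p"
  shows "y powr p + p * y powr (p - 1) * (x - y) \<le> x powr p"
proof -
  consider "y = 0" | "y > 0" "x = 0" | "y > 0" "x > 0"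
    using assms by linarith
  then show ?thesis
  proof cases
    case 2
    then have "y powr (p - 1) * y = y powr p"
      by (simp add: powr_diff)
    moreover have "1 * y powr p \<le> p * y powr p"
      using assms by (intro mult_right_mono) auto
    ultimately show ?thesis
      using 2 by (simp add: algebra_simps)
  next
    case 3
    have "p * y powr (p - 1) * (x - y) \<le> x powr p - y powr p"
      using 3 assms
      by (intro convex_on_imp_above_tangent[OF powr_convex[OF \<open>1 \<le> p\<close>]])
         (auto intro!: derivative_eq_intros simp: interior_open)
    then show ?thesis by simp
  qed (use assms in auto)
qed

text \<open>In the variable s = 1 / t the expression becomes
  \<open>(1 - p * s) * (1 - s) powr (- p)\<close>. Its derivative collapses to
  \<open>p * (1 - p) * s * (1 - s) powr (- p - 1)\<close>, which is negative on (0, 1).\<close>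

lemma exponent_strict_mono:
  fixes p q r :: real
  assumes "1 < p" "p \<le> q" "q < r"
  shows "(q - p) / q * (q / (q - 1)) powr p < (r - p) / r * (r / (r - 1)) powr p"
proof -
  define G where "G = (\<lambda>s::real. (1 - p * s) * (1 - s) powr (- p))"
  have G: "(t - p) / t * (t / (t - 1)) powr p = G (1 / t)" if "p \<le> t" for t
  proof -
    have t: "t > 1" using that assms by linarith
    have "1 - 1 / t = inverse (t / (t - 1))"
      using t by (simp add: field_simps)
    then have "(1 - 1 / t) powr (- p) = (t / (t - 1)) powr p"
      by (simp only: powr_minus inverse_powr inverse_inverse_eq)
    then show ?thesis
      using t by (simp add: G_def field_simps)
  qed
  have r: "1 / r < 1 / q"
    using assms by (intro divide_strict_left_mono) auto
  have "G (1 / r) > G (1 / q)"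
  proof (rule DERIV_neg_imp_decreasing[OF r])
    fix s assume s: "1 / r \<le> s" "s \<le> 1 / q"
    have "0 < 1 / r" "1 / q < 1"
      using assms by auto
    with s have s01: "0 < s" "s < 1" by linarith+
    have eq: "(1 - s) powr (- p) = (1 - s) * (1 - s) powr (- p - 1)"
      using s01 powr_add[of "1 - s" 1 "- p - 1"] by simp
    have "(G has_real_derivative
        - p * (1 - s) powr (- p) + (1 - p * s) * (p * (1 - s) powr (- p - 1))) (at s)"
      unfolding G_def using s01 by (auto intro!: derivative_eq_intros)
    then have "(G has_real_derivative p * (1 - p) * s * (1 - s) powr (- p - 1)) (at s)"
      by (rule DERIV_cong) (simp only: eq, simp add: algebra_simps)
    moreover have "p * (1 - p) * s * (1 - s) powr (- p - 1) < 0"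
      using s01 assms by (simp add: mult_less_0_iff zero_less_mult_iff)
    ultimately show "\<exists>y. DERIV G s :> y \<and> y < 0" by blast
  qed
  then show ?thesis
    using assms by (simp only: G[of q] G[of r])
qed

text \<open>For \<open>u = y / N\<close> and \<open>v = (q - 1) / q\<close> this is the tangent inequality for
  \<open>u\<^sup>p\<close> at \<open>v\<close>, the value that \<open>u\<close> takes for the extremal power function.\<close>

lemma pointwise_bound:
  fixes p q K y N :: real
  assumes "1 < p" "p < q" "0 \<le> y" "0 < N"
  defines "v \<equiv> (q - 1) / q"
  defines "\<eta> \<equiv> p * (v powr (p - 1) / (q - p) - 1 / (q - 1))"
  shows "(v powr p / (q - p) - K / q) * N powr q \<le>
    y powr p * N powr (q - p) / (q - p) - p * (y * N powr (q - 1)) / (q - 1) + (p - K) * N powr q / q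
      + \<eta> * (v * N powr q - y * N powr (q - 1))"
proof -
  define u where "u = y / N"
  have y: "y = u * N" and u: "0 \<le> u"
    using assms by (auto simp: u_def)
  have v: "0 < v" using assms by (simp add: v_def)
  have "v powr p + p * v powr (p - 1) * (u - v) \<le> u powr p"
    by (rule powr_ge_tangent) (use u v assms in auto)
  then have "(v powr p + p * v powr (p - 1) * (u - v)) / (q - p) \<le> u powr p / (q - p)"
    using assms by (intro divide_right_mono) auto
  moreover have "p * v / (q - 1) = p / q"
    using assms by (simp add: v_def)
  ultimately have *: "v powr p / (q - p) - K / q \<le>
      u powr p / (q - p) - p * u / (q - 1) + (p - K) / q + \<eta> * (v - u)"
    by (simp add: \<eta>_def algebra_simps diff_divide_distrib add_divide_distrib)
  have "(v powr p / (q - p) - K / q) * N powr q \<le>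
      (u powr p / (q - p) - p * u / (q - 1) + (p - K) / q + \<eta> * (v - u)) * N powr q"
    by (rule mult_right_mono[OF *]) simp
  moreover have "y powr p * N powr (q - p) = u powr p * N powr q"
    using u assms by (simp add: y powr_mult mult.assoc flip: powr_add)
  moreover have "y * N powr (q - 1) = u * N powr q"
    using assms by (simp add: y powr_diff)
  ultimately show ?thesis
    by (simp add: algebra_simps diff_divide_distrib)
qed

text \<open>Shows that the multiplier \<eta> of \<open>pointwise_bound\<close> is nonnegative, so
  that an integral inequality can later be scaled by it. The tangent of u^p at 1, evaluated at (q -
  1) / q, gives 1 - p / q as a lower bound.\<close>

lemma Bernoulli_quotient:
  fixes p q :: real
  assumes "1 < p" "p < q"
  shows "1 / (q - 1) \<le> ((q - 1) / q) powr (p - 1) / (q - p)"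
proof -
  have "1 powr p + p * 1 powr (p - 1) * ((q - 1) / q - 1) \<le> ((q - 1) / q) powr p"
    by (rule powr_ge_tangent) (use assms in auto)
  also have "((q - 1) / q) powr p = ((q - 1) / q) powr (p - 1) * ((q - 1) / q)"
    using assms by (simp add: powr_diff)
  finally have "(q - p) / q \<le> ((q - 1) / q) powr (p - 1) * ((q - 1) / q)"
    using assms by (simp add: field_simps)
  then have "(q - p) / q * q \<le> ((q - 1) / q) powr (p - 1) * ((q - 1) / q) * q"
    using assms by (intro mult_right_mono) auto
  then have "q - p \<le> ((q - 1) / q) powr (p - 1) * (q - 1)"
    using assms by simp
  then show ?thesis
    using assms by (simp add: field_simps)
qed

section \<open>Integration over levels\<close>

text \<open>Fubini, with the inner integral of \<open>l powr (s - 1)\<close> running from L to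
  \<open>max L (V x)\<close>. The cutoff L is there because the level estimates hold only above the
  average over the whole space; points with \<open>V x \<le> L\<close> contribute nothing on either
  side.\<close>

lemma (in prob_space) layer_cake_powr:
  fixes w V :: "'a \<Rightarrow> real" and L B s :: real
  assumes w: "integrable M w" "\<And>x. x \<in> space M \<Longrightarrow> 0 \<le> w x"
    and V: "V \<in> borel_measurable M" "\<And>x. x \<in> space M \<Longrightarrow> V x \<le> B"
    and L: "0 < L" "L \<le> B" and s: "0 < s"
  shows "integrable M (\<lambda>x. w x * (max L (V x) powr s - L powr s))" (is ?int)
    and "has_bochner_integral lborel
      (\<lambda>l. indicator {L..B} l * (l powr (s - 1) * (LINT x:{x\<in>space M. l < V x}|M. w x)))
      (LINT x|M. w x * (max L (V x) powr s - L powr s) / s)" (is ?has)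
proof -
  have [measurable]: "w \<in> borel_measurable M" "V \<in> borel_measurable M"
    using w V by auto
  have N: "max L (V x) powr s - L powr s \<ge> 0" "max L (V x) powr s - L powr s \<le> B powr s" 
    if "x \<in> space M" for x
  proof -
    have "L powr s \<le> max L (V x) powr s" "max L (V x) powr s \<le> B powr s"
      using L V s that by (auto intro!: powr_mono2)
    then show "max L (V x) powr s - L powr s \<ge> 0" "max L (V x) powr s - L powr s \<le> B powr s"
      using powr_ge_zero[of L s] by linarith+
  qed
  show int: ?int
  proof (rule Bochner_Integration.integrable_bound)
    show "integrable M (\<lambda>x. B powr s * w x)" using w by simp
    show "AE x in M. norm (w x * (max L (V x) powr s - L powr s)) \<le> norm (B powr s * w x)"
    proof (rule AE_I2)
      fix x assume "x \<in> space M"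
      then show "norm (w x * (max L (V x) powr s - L powr s)) \<le> norm (B powr s * w x)"
        using N[of x] w(2)[of x] by (simp add: abs_mult mult.commute mult_left_mono)
    qed
  qed simp
  \<comment> \<open>The exchange is done for nonnegative extended values, so integrability in l
    comes out as a result instead of being a premise.\<close>
  define f where "f l x = ennreal (indicator {L..B} l * (l powr (s - 1) * (indicator {x\<in>space M. l < V x} x * w x)))"
    for l x
  have pair: "pair_sigma_finite lborel M"
    by (intro pair_sigma_finite.intro sigma_finite_lborel sigma_finite_measure_axioms)
  have int_w: "integrable M (\<lambda>x. indicator {x\<in>space M. l < V x} x * w x)" for l
    using integrable_mult_indicator[OF _ w(1), of "{x\<in>space M. l < V x}"] by simp
  have "(\<integral>\<^sup>+l. \<integral>\<^sup>+x. f l x \<partial>M \<partial>lborel) = (\<integral>\<^sup>+x. \<integral>\<^sup>+l. f l x \<partial>lborel \<partial>M)"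
  proof (rule pair_sigma_finite.Fubini'[OF pair, symmetric])
    have "(\<lambda>(l, x). indicator {L..B} l * (l powr (s - 1) * ((if l < V x then 1 else 0) * w x)))
        \<in> borel_measurable (lborel \<Otimes>\<^sub>M M)"
      by measurable
    then have "(\<lambda>(l, x). ennreal (indicator {L..B} l * (l powr (s - 1) * ((if l < V x then 1 else 0) * w x))))
        \<in> borel_measurable (lborel \<Otimes>\<^sub>M M)"
      by measurable
    also have "?this \<longleftrightarrow> case_prod f \<in> borel_measurable (lborel \<Otimes>\<^sub>M M)"
      by (intro measurable_cong) (auto simp: f_def space_pair_measure indicator_def)
    finally show "case_prod f \<in> borel_measurable (lborel \<Otimes>\<^sub>M M)" .
  qed
  also have "\<dots> = (\<integral>\<^sup>+x. ennreal (w x * (max L (V x) powr s - L powr s) / s) \<partial>M)"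
  proof (rule nn_integral_cong)
    fix x assume x: "x \<in> space M"
    have "(\<integral>\<^sup>+l. f l x \<partial>lborel) =
        (\<integral>\<^sup>+l. ennreal (w x) * (ennreal (l powr (s - 1)) * indicator {L..max L (V x)} l) \<partial>lborel)"
    proof (rule nn_integral_cong_AE)
      \<comment> \<open>The level set is given by a strict inequality but the interval is closed;
        the integrands differ at most at this endpoint.\<close>
      have "AE l in lborel. l \<noteq> max L (V x)"
        by (rule AE_lborel_singleton)
      then show "AE l in lborel. f l x =
          ennreal (w x) * (ennreal (l powr (s - 1)) * indicator {L..max L (V x)} l)"
      proof (rule AE_mp, intro AE_I2 impI)
        fix l :: real assume "l \<noteq> max L (V x)"
        then show "f l x = ennreal (w x) * (ennreal (l powr (s - 1)) * indicator {L..max L (V x)} l)"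
          using w(2)[OF x] V(2)[OF x] x L
          by (auto simp: f_def indicator_def max_def mult.commute simp flip: ennreal_mult split: if_splits)
      qed
    qed
    also have "\<dots> = ennreal (w x) * (\<integral>\<^sup>+l. ennreal (l powr (s - 1)) * indicator {L..max L (V x)} l \<partial>lborel)"
      by (rule nn_integral_cmult) simp
    also have "(\<integral>\<^sup>+l. ennreal (l powr (s - 1)) * indicator {L..max L (V x)} l \<partial>lborel) =
        max L (V x) powr s / s - L powr s / s"
      using L s by (intro nn_integral_FTC_Icc) (auto intro!: derivative_eq_intros)
    finally show "(\<integral>\<^sup>+l. f l x \<partial>lborel) = ennreal (w x * (max L (V x) powr s - L powr s) / s)"
      using w(2)[OF x] by (simp add: diff_divide_distrib right_diff_distrib flip: ennreal_mult')
  qed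
  also have "\<dots> = ennreal (LINT x|M. w x * (max L (V x) powr s - L powr s) / s)"
  proof (rule nn_integral_eq_integral)
    show "integrable M (\<lambda>x. w x * (max L (V x) powr s - L powr s) / s)"
      using int by simp
  qed (use N w s in auto)
  finally have eq: "(\<integral>\<^sup>+l. \<integral>\<^sup>+x. f l x \<partial>M \<partial>lborel) = ennreal (LINT x|M. w x * (max L (V x) powr s - L powr s) / s)" .
  have inner: "(\<integral>\<^sup>+x. f l x \<partial>M) =
      ennreal (indicator {L..B} l * (l powr (s - 1) * (LINT x:{x\<in>space M. l < V x}|M. w x)))" for l
  proof -
    have "(\<integral>\<^sup>+x. f l x \<partial>M) = ennreal (LINT x|M. indicator {L..B} l * (l powr (s - 1) * (indicator {x\<in>space M. l < V x} x * w x)))"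
      unfolding f_def
      by (rule nn_integral_eq_integral) (use int_w w in \<open>auto simp: indicator_def\<close>)
    then show ?thesis
      by (simp add: set_lebesgue_integral_def)
  qed
  have meas: "(\<lambda>l. LINT x:{x\<in>space M. l < V x}|M. w x) \<in> borel_measurable borel"
  proof -
    have "(\<lambda>l. LINT x|M. (if l < V x then 1 else 0) * w x) \<in> borel_measurable borel"
      by measurable
    also have "(\<lambda>l. LINT x|M. (if l < V x then 1 else 0) * w x) = (\<lambda>l. LINT x:{x\<in>space M. l < V x}|M. w x)"
      by (auto simp: set_lebesgue_integral_def intro!: Bochner_Integration.integral_cong)
    finally show ?thesis .
  qed
  show ?has
  proof (rule has_bochner_integral_nn_integral)
    show "(\<lambda>l. indicator {L..B} l * (l powr (s - 1) * (LINT x:{x\<in>space M. l < V x}|M. w x))) \<in> borel_measurable lborel"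
      using meas by measurable
    show "AE l in lborel. 0 \<le> indicator {L..B} l * (l powr (s - 1) * (LINT x:{x\<in>space M. l < V x}|M. w x))"
      unfolding set_lebesgue_integral_def
      by (intro AE_I2 mult_nonneg_nonneg Bochner_Integration.integral_nonneg) (auto simp: w indicator_def)
    show "0 \<le> (LINT x|M. w x * (max L (V x) powr s - L powr s) / s)"
      by (intro Bochner_Integration.integral_nonneg) (use w N s in auto)
  qed (use eq in \<open>simp add: inner\<close>)
qed

section \<open>The tree, its averages and the reverse Holder inequality\<close>

text \<open>The children form a fixed function \<open>C\<close>, so that the maximal function can be
  defined by recursion along the tree.\<close>

locale reverse_Holder_tree = prob_space M
  for M :: "'a measure" +
  fixes k :: nat and T :: "'a set set" and C :: "'a set \<Rightarrow> 'a set set"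
    and \<phi> :: "'a \<Rightarrow> real" and p c :: real
  assumes k: "1 < k"
    and T_sets: "T \<subseteq> sets M" and space_T: "space M \<in> T"
    and children_T: "I \<in> T \<Longrightarrow> C I \<subseteq> T"
    and card_children: "I \<in> T \<Longrightarrow> card (C I) = k"
    and disjoint_children: "I \<in> T \<Longrightarrow> disjoint (C I)"
    and Union_children: "I \<in> T \<Longrightarrow> \<Union>(C I) = I"
    and measure_child: "I \<in> T \<Longrightarrow> J \<in> C I \<Longrightarrow> measure M J = measure M I / real k"
    and nonneg: "x \<in> space M \<Longrightarrow> 0 \<le> \<phi> x"
    and int_phi: "integrable M \<phi>"
    and p: "1 < p" and c: "1 \<le> c"
    and rev_Holder: "reverse_Holder_on M T p c \<phi>"
begin

lemma finite_children: "I \<in> T \<Longrightarrow> finite (C I)"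
  using card_children k by (metis card.infinite not_one_less_zero)

lemma child_T: "I \<in> T \<Longrightarrow> J \<in> C I \<Longrightarrow> J \<in> T"
  using children_T by blast

lemma child_subset: "I \<in> T \<Longrightarrow> J \<in> C I \<Longrightarrow> J \<subseteq> I"
  using Union_children by blast

lemma sets_T [measurable]: "I \<in> T \<Longrightarrow> I \<in> sets M"
  using T_sets by blast

lemma subset_space: "I \<in> T \<Longrightarrow> I \<subseteq> space M"
  using sets.sets_into_space sets_T by blast

lemma measure_child_pos: "I \<in> T \<Longrightarrow> J \<in> C I \<Longrightarrow> 0 < measure M I \<Longrightarrow> 0 < measure M J"
  using measure_child k by simp

lemma borel_phi [measurable]: "\<phi> \<in> borel_measurable M"
  using int_phi by simp

lemma set_integrableI: "integrable M (f :: 'a \<Rightarrow> real) \<Longrightarrow> A \<in> sets M \<Longrightarrow> set_integrable M A f"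
  using integrable_mult_indicator[of A M f] by (simp add: set_integrable_def)

definition avg :: "'a set \<Rightarrow> real" where
  "avg I = 1 / measure M I * (LINT x:I|M. \<phi> x)"

lemma avg_mult: "0 < measure M I \<Longrightarrow> avg I * measure M I = (LINT x:I|M. \<phi> x)"
  by (simp add: avg_def)

lemma set_integral_phi_nonneg: "A \<in> sets M \<Longrightarrow> 0 \<le> (LINT x:A|M. \<phi> x)"
  unfolding set_lebesgue_integral_def
  by (intro Bochner_Integration.integral_nonneg) (simp add: nonneg)

lemma avg_nonneg: "I \<in> T \<Longrightarrow> 0 \<le> avg I"
  unfolding avg_def by (intro mult_nonneg_nonneg set_integral_phi_nonneg) auto

lemma reverse_Holder_nn:
  assumes I: "I \<in> T" "0 < measure M I"
  shows "(\<integral>\<^sup>+x\<in>I. ennreal (\<phi> x powr p) \<partial>M) \<le> ennreal (c * avg I powr p * measure M I)"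
proof -
  let ?i = "\<integral>\<^sup>+x\<in>I. ennreal (\<phi> x powr p) \<partial>M"
  have eI: "emeasure M I = ennreal (measure M I)"
    by (simp add: emeasure_eq_measure)
  have "?i / emeasure M I \<le> ennreal (c * avg I powr p)"
    using rev_Holder I by (simp add: reverse_Holder_on_def avg_def)
  then have "?i / emeasure M I * emeasure M I \<le> ennreal (c * avg I powr p) * emeasure M I"
    by (rule mult_right_mono) simp
  also have "?i / emeasure M I * emeasure M I = ?i"
    using I by (simp add: eI ennreal_divide_times mult_divide_eq_ennreal)
  finally show ?thesis
    using c by (simp add: eI flip: ennreal_mult)
qed

lemma int_phi_powr: "integrable M (\<lambda>x. \<phi> x powr p)"
proof (rule integrableI_nonneg)
  have "(\<integral>\<^sup>+x. ennreal (\<phi> x powr p) \<partial>M) = (\<integral>\<^sup>+x\<in>space M. ennreal (\<phi> x powr p) \<partial>M)"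
    by (intro nn_integral_cong) auto
  also have "\<dots> < \<infinity>"
    using reverse_Holder_nn[OF space_T] prob_space by (auto simp: le_less_trans)
  finally show "(\<integral>\<^sup>+x. ennreal (\<phi> x powr p) \<partial>M) < \<infinity>" .
qed auto

lemma reverse_Holder_integral:
  assumes I: "I \<in> T" "0 < measure M I"
  shows "(LINT x:I|M. \<phi> x powr p) \<le> c * avg I powr p * measure M I"
proof -
  have "ennreal (LINT x:I|M. \<phi> x powr p) = (\<integral>\<^sup>+x\<in>I. ennreal (\<phi> x powr p) \<partial>M)"
    unfolding set_lebesgue_integral_def
    using I integrable_mult_indicator[OF sets_T[OF I(1)] int_phi_powr]
    by (subst nn_integral_eq_integral[symmetric])
       (auto intro!: nn_integral_cong simp: indicator_def)
  also have "\<dots> \<le> ennreal (c * avg I powr p * measure M I)"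
    by (rule reverse_Holder_nn[OF I])
  finally show ?thesis
    using c by (subst (asm) ennreal_le_iff) auto
qed

section \<open>The truncated maximal function and its level sets\<close>

text \<open>For x in a tree set I this is the largest average over the descendants of I that contain
  x, down to n generations. Disjointness of the children leaves one relevant summand; the sum avoids
  choosing the child and keeps measurability immediate.\<close>

primrec tree_max :: "nat \<Rightarrow> 'a set \<Rightarrow> 'a \<Rightarrow> real" where
  "tree_max 0 I x = avg I"
| "tree_max (Suc n) I x = max (avg I) (\<Sum>J\<in>C I. indicator J x * tree_max n J x)"

lemma tree_max_child:
  assumes "I \<in> T" "J \<in> C I" "x \<in> J"
  shows "tree_max (Suc n) I x = max (avg I) (tree_max n J x)"
proof -
  have "(\<Sum>K\<in>C I. indicator K x * tree_max n K x) = (\<Sum>K\<in>C I. if K = J then tree_max n J x else 0)"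
  proof (rule sum.cong[OF refl])
    fix K assume "K \<in> C I"
    then show "indicator K x * tree_max n K x = (if K = J then tree_max n J x else 0)"
      using disjoint_children[OF assms(1)] assms by (auto simp: disjoint_def indicator_def)
  qed
  then show ?thesis
    using assms finite_children by simp
qed

lemma tree_max_measurable: "I \<in> T \<Longrightarrow> tree_max n I \<in> borel_measurable M"
proof (induction n arbitrary: I)
  case (Suc n)
  then have "(\<lambda>x. \<Sum>J\<in>C I. indicator J x * tree_max n J x) \<in> borel_measurable M"
    by (intro borel_measurable_sum borel_measurable_times borel_measurable_indicator)
       (auto intro: sets_T child_T[OF Suc.prems])
  then have "(\<lambda>x. max (avg I) (\<Sum>J\<in>C I. indicator J x * tree_max n J x)) \<in> borel_measurable M"
    by simp
  moreover have "tree_max (Suc n) I = (\<lambda>x. max (avg I) (\<Sum>J\<in>C I. indicator J x * tree_max n J x))"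
    by (rule ext) simp
  ultimately show ?case by simp
next
  case (0 I)
  have "tree_max 0 I = (\<lambda>x. avg I)" by (rule ext) simp
  then show ?case by simp
qed

lemma avg_le_tree_max: "avg I \<le> tree_max n I x"
  by (cases n) auto

text \<open>Only finitely many averages occur down to depth n. The bound depends on n and serves
  only as the upper limit of the level integrals. Having \<open>I \<in> T\<close> under the
  existential lets a bound be chosen as a function of I.\<close>

lemma tree_max_bounded: "\<exists>B. \<forall>x\<in>I. I \<in> T \<longrightarrow> tree_max n I x \<le> B"
proof (induction n arbitrary: I)
  case (Suc n)
  then obtain B where B: "\<And>I x. x \<in> I \<Longrightarrow> I \<in> T \<Longrightarrow> tree_max n I x \<le> B I"
    by metis
  have "tree_max (Suc n) I x \<le> max (avg I) (Max (B ` C I))" if x: "x \<in> I" and I: "I \<in> T" for x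
  proof -
    obtain J where J: "J \<in> C I" "x \<in> J"
      using Union_children[OF I] x by blast
    have "tree_max n J x \<le> B J"
      using B[OF J(2)] child_T[OF I J(1)] by simp
    also have "B J \<le> Max (B ` C I)"
      using finite_children[OF I] J by (intro Max_ge) auto
    finally show ?thesis
      by (auto simp: tree_max_child[OF I J] simp del: tree_max.simps)
  qed
  then show ?case by blast
qed auto

definition level :: "real \<Rightarrow> nat \<Rightarrow> 'a set \<Rightarrow> 'a set" where
  "level l n I = {x \<in> I. l < tree_max n I x}"

lemma level_subset: "level l n I \<subseteq> I"
  by (auto simp: level_def)

lemma level_sets: "I \<in> T \<Longrightarrow> level l n I \<in> sets M"
proof -
  assume I: "I \<in> T"
  note [measurable] = tree_max_measurable[OF I]
  have "level l n I = I \<inter> {x \<in> space M. l < tree_max n I x}"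
    using subset_space[OF I] by (auto simp: level_def)
  then show ?thesis using I by simp
qed

lemma level_all: "l < avg I \<Longrightarrow> level l n I = I"
  by (auto simp: level_def intro: order.strict_trans2[OF _ avg_le_tree_max])

lemma level_0: "avg I \<le> l \<Longrightarrow> level l 0 I = {}"
  by (auto simp: level_def)

text \<open>Since \<open>avg I\<close> does not exceed l, the maximum exceeds l only through its
  second argument, which is decided in the child containing x.\<close>

lemma level_Suc:
  assumes "I \<in> T" "avg I \<le> l"
  shows "level l (Suc n) I = (\<Union>J\<in>C I. level l n J)"
proof -
  have eq: "x \<in> level l (Suc n) I \<longleftrightarrow> x \<in> level l n J" if "J \<in> C I" "x \<in> J" for x J
    using child_subset[OF assms(1) that(1)] that(2) assms(2)
    by (auto simp: level_def tree_max_child[OF assms(1) that] simp del: tree_max.simps)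
  show ?thesis
  proof (intro equalityI subsetI)
    fix x assume x: "x \<in> level l (Suc n) I"
    then obtain J where "J \<in> C I" "x \<in> J"
      using Union_children[OF assms(1)] level_subset[of l "Suc n" I] by blast
    with x show "x \<in> (\<Union>J\<in>C I. level l n J)"
      using eq by blast
  next
    fix x assume "x \<in> (\<Union>J\<in>C I. level l n J)"
    then obtain J where J: "J \<in> C I" "x \<in> level l n J" by blast
    then have "x \<in> J" by (simp add: level_def)
    with J eq[OF J(1)] show "x \<in> level l (Suc n) I" by blast
  qed
qed

lemma integral_level_Suc:
  assumes I: "I \<in> T" "avg I \<le> l" and f: "integrable M (f :: 'a \<Rightarrow> real)"
  shows "(LINT x:level l (Suc n) I|M. f x) = (\<Sum>J\<in>C I. LINT x:level l n J|M. f x)"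
  unfolding level_Suc[OF I]
proof (rule set_integral_finite_Union)
  show "disjoint_family_on (\<lambda>J. level l n J) (C I)"
    unfolding disjoint_family_on_def
  proof (intro ballI impI)
    fix J K assume "J \<in> C I" "K \<in> C I" "J \<noteq> K"
    then have "J \<inter> K = {}"
      using disjoint_children[OF I(1)] by (simp add: disjoint_def)
    then show "level l n J \<inter> level l n K = {}"
      using level_subset[of l n J] level_subset[of l n K] by blast
  qed
next
  fix J assume "J \<in> C I"
  then show "level l n J \<in> sets M"
    by (intro level_sets child_T[OF I(1)])
  then show "set_integrable M (level l n J) f"
    by (rule set_integrableI[OF f])
qed (rule finite_children[OF I(1)])

lemma measure_level_Suc:
  assumes "I \<in> T" "avg I \<le> l"
  shows "measure M (level l (Suc n) I) = (\<Sum>J\<in>C I. measure M (level l n J))"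
proof -
  have "level l n J \<in> sets M" if "J \<in> C I" for J
    using that by (intro level_sets child_T[OF assms(1)])
  moreover have "level l (Suc n) I \<in> sets M"
    using assms(1) by (rule level_sets)
  ultimately show ?thesis
    using integral_level_Suc[OF assms, of "\<lambda>_. 1" n] by (simp add: set_lebesgue_integral_def)
qed

section \<open>Estimates on level sets\<close>

text \<open>The weak-type bound: the level set splits into disjoint tree sets with average above l.
  The induction descends until such a set is met, and there the level set is the whole tree
  set.\<close>

lemma level_mass:
  assumes "I \<in> T" "0 < measure M I"
  shows "l * measure M (level l n I) \<le> (LINT x:level l n I|M. \<phi> x)"
  using assms
proof (induction n arbitrary: I)
  case (Suc n I)
  show ?case
  proof (cases "l < avg I")
    case True
    then have "l * measure M I \<le> avg I * measure M I"
      by (intro mult_right_mono) auto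
    then show ?thesis
      using Suc.prems True by (simp add: level_all avg_mult)
  next
    case False
    then have "l * measure M (level l (Suc n) I) = (\<Sum>J\<in>C I. l * measure M (level l n J))"
      using Suc.prems by (simp add: measure_level_Suc sum_distrib_left)
    also have "\<dots> \<le> (\<Sum>J\<in>C I. LINT x:level l n J|M. \<phi> x)"
      using Suc by (intro sum_mono)
        (auto intro: child_T[OF Suc.prems(1)] measure_child_pos[OF Suc.prems(1)])
    finally show ?thesis
      using Suc.prems False int_phi by (simp add: integral_level_Suc)
  qed
next
  case (0 I)
  show ?case
  proof (cases "l < avg I")
    case True
    then have "l * measure M I \<le> avg I * measure M I"
      by (intro mult_right_mono) auto
    then show ?thesis
      using 0 True by (simp add: level_all avg_mult)
  qed (simp add: level_0 set_lebesgue_integral_def)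
qed

text \<open>The essential step: if some child \<open>J\<close> has average above \<open>l\<close>, the level set
  fills at least the fraction \<open>1 / k\<close> of \<open>I\<close>, while the convexity gap
  \<open>\<phi>\<^sup>p - a\<^sup>p - p a\<^sup>p\<^sup>-\<^sup>1 (\<phi> - a)\<close> at \<open>a = avg I\<close> is nonnegative
  and has integral at most \<open>(c - 1) a\<^sup>p \<mu>(I)\<close>. Since the average over the level set is
  at least \<open>l \<ge> a\<close>, moving the tangent point up to \<open>l\<close> only decreases the gap there.\<close>

lemma level_power_step:
  assumes I: "I \<in> T" "0 < measure M I" "avg I \<le> l" and l: "0 < l"
    and J: "J \<in> C I" "l < avg J"
  shows "(LINT x:level l (Suc n) I|M. \<phi> x powr p)
      - p * l powr (p - 1) * (LINT x:level l (Suc n) I|M. \<phi> x)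
      + (p - 1 - real k * (c - 1)) * l powr p * measure M (level l (Suc n) I) \<le> 0"
proof -
  define S where "S = level l (Suc n) I"
  define a where "a = avg I"
  have S: "S \<in> sets M" "S \<subseteq> I"
    using level_sets[OF I(1)] level_subset by (auto simp: S_def)
  have a: "0 \<le> a" "a \<le> l"
    using I avg_nonneg by (auto simp: a_def)
  have JS: "J \<subseteq> S"
    using level_all[OF J(2), of n] level_Suc[OF I(1,3), of n] J(1) by (auto simp: S_def)
  have mS: "measure M I \<le> real k * measure M S"
  proof -
    have "measure M I = real k * measure M J"
      using measure_child[OF I(1) J(1)] k by simp
    also have "\<dots> \<le> real k * measure M S"
      using finite_measure_mono[OF JS S(1)] by (intro mult_left_mono) auto
    finally show ?thesis .
  qed
  define h where "h x = \<phi> x powr p - (a powr p + p * a powr (p - 1) * (\<phi> x - a))" for x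
  have int_h: "integrable M h"
    unfolding h_def using int_phi int_phi_powr by auto
  have h: "(LINT x:A|M. h x) = (LINT x:A|M. \<phi> x powr p) - p * a powr (p - 1) * (LINT x:A|M. \<phi> x)
      + (p - 1) * a powr p * measure M A" if A: "A \<in> sets M" for A
  proof -
    have "a powr (p - 1) * a = a powr p"
      using a by (cases "a = 0") (auto simp: powr_diff)
    then have "indicator A x * h x = indicator A x * \<phi> x powr p
        - p * a powr (p - 1) * (indicator A x * \<phi> x) + (p - 1) * a powr p * indicator A x" for x
      by (simp add: h_def algebra_simps)
    moreover have "integrable M (\<lambda>x. indicator A x * \<phi> x)" "integrable M (\<lambda>x. indicator A x * \<phi> x powr p)"
      using integrable_mult_indicator[OF A int_phi] integrable_mult_indicator[OF A int_phi_powr] by auto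
    moreover have "integrable M (\<lambda>x. indicator A x :: real)"
      using A by (simp add: emeasure_eq_measure)
    ultimately show ?thesis
      using A by (simp add: set_lebesgue_integral_def)
  qed
  have "(LINT x:S|M. h x) \<le> (LINT x:I|M. h x)"
    unfolding set_lebesgue_integral_def
  proof (rule integral_mono)
    fix x assume "x \<in> space M"
    then have "0 \<le> h x"
      using powr_ge_tangent[of "\<phi> x" a p] nonneg[of x] a p by (simp add: h_def)
    then show "indicator S x *\<^sub>R h x \<le> indicator I x *\<^sub>R h x"
      using S by (auto simp: indicator_def)
  qed (use set_integrableI[OF int_h] S I in \<open>auto simp: set_integrable_def\<close>)
  also have "\<dots> \<le> (c - 1) * a powr p * measure M I"
  proof -
    have "a powr (p - 1) * (LINT x:I|M. \<phi> x) = a powr p * measure M I"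
      using a by (cases "a = 0") (auto simp: powr_diff a_def avg_mult[OF I(2), symmetric])
    then show ?thesis
      using h[OF sets_T[OF I(1)]] reverse_Holder_integral[OF I(1,2)]
      by (simp add: a_def algebra_simps)
  qed
  also have "\<dots> \<le> (c - 1) * l powr p * (real k * measure M S)"
    using mS a p c by (intro mult_mono powr_mono2) auto
  finally have upper: "(LINT x:S|M. h x) \<le> (c - 1) * l powr p * (real k * measure M S)" .
  have mass: "l * measure M S \<le> (LINT x:S|M. \<phi> x)"
    using level_mass[OF I(1,2)] by (simp add: S_def)
  \<comment> \<open>The gap at a minus the gap at l, integrated over \<open>S\<close>, increases
    with the integral of \<phi>. By \<open>mass\<close> it suffices to take that integral equal to
    \<open>l * measure M S\<close>, where the claim is the tangent inequality at a evaluated at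
    l.\<close>
  have "p * (l powr (p - 1) - a powr (p - 1)) * (l * measure M S)
      \<le> p * (l powr (p - 1) - a powr (p - 1)) * (LINT x:S|M. \<phi> x)"
    using mass a p by (intro mult_left_mono mult_nonneg_nonneg) (auto intro: powr_mono2)
  moreover have "(a powr p + p * a powr (p - 1) * (l - a)) * measure M S \<le> l powr p * measure M S"
    by (intro mult_right_mono powr_ge_tangent) (use a p l in auto)
  moreover have "a powr (p - 1) * a = a powr p" "l powr (p - 1) * l = l powr p"
    using a l by (cases "a = 0"; auto simp: powr_diff)+
  then have "p * (l powr (p - 1) * (l * measure M S)) = p * (l powr p * measure M S)"
    "p * (a powr (p - 1) * (a * measure M S)) = p * (a powr p * measure M S)"
    by (simp_all flip: mult.assoc)
  ultimately show ?thesis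
    using upper h[OF S(1)] unfolding S_def[symmetric]
    by (simp only: algebra_simps mult_1_left mult_1_right)
qed

text \<open>The inequality is additive over children, so the induction passes through nodes none of
  whose children has average above l; at the first node with such a child
  \<open>level_power_step\<close> applies. The coefficient equals p - K.\<close>

lemma level_power:
  assumes "I \<in> T" "0 < measure M I" "avg I \<le> l" "0 < l"
  shows "(LINT x:level l n I|M. \<phi> x powr p) - p * l powr (p - 1) * (LINT x:level l n I|M. \<phi> x)
      + (p - 1 - real k * (c - 1)) * l powr p * measure M (level l n I) \<le> 0"
  using assms
proof (induction n arbitrary: I)
  case (Suc n I)
  show ?case
  proof (cases "\<exists>J\<in>C I. l < avg J")
    case True
    then show ?thesis using level_power_step[OF Suc.prems] by blast
  next
    case False
    have "(\<Sum>J\<in>C I. (LINT x:level l n J|M. \<phi> x powr p)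
        - p * l powr (p - 1) * (LINT x:level l n J|M. \<phi> x)
        + (p - 1 - real k * (c - 1)) * l powr p * measure M (level l n J)) \<le> 0"
      using Suc False by (intro sum_nonpos)
        (auto simp: not_less intro: child_T[OF Suc.prems(1)] measure_child_pos[OF Suc.prems(1)])
    then show ?thesis
      unfolding integral_level_Suc[OF Suc.prems(1,3) int_phi]
        integral_level_Suc[OF Suc.prems(1,3) int_phi_powr] measure_level_Suc[OF Suc.prems(1,3)]
      by (simp only: sum.distrib sum_subtractf sum_distrib_left)
  qed
qed (simp add: level_0 set_lebesgue_integral_def)

section \<open>Bound for the maximal function, uniform in the depth\<close>

lemma tree_max_powr_bounded:
  fixes q :: real
  defines "K \<equiv> real k * c - real k + 1"
  assumes q: "p < q" and K: "(q - p) / q * (q / (q - 1)) powr p * K < 1"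
  shows "\<exists>L D. \<forall>n. (\<integral>\<^sup>+x. ennreal (max L (tree_max n (space M) x) powr q) \<partial>M) \<le> ennreal D"
proof -
  let ?X = "space M"
  \<comment> \<open>Adding 1 keeps L positive even when the average is 0.\<close>
  define L where "L = avg ?X + 1"
  have L: "0 < L" "avg ?X \<le> L"
    using avg_nonneg[OF space_T] by (auto simp: L_def)
  define v where "v = (q - 1) / q"
  define \<eta> where "\<eta> = p * (v powr (p - 1) / (q - p) - 1 / (q - 1))"
  define \<delta> where "\<delta> = v powr p / (q - p) - K / q"
  define P where "P = (LINT x|M. \<phi> x powr p)"
  define F where "F = (LINT x|M. \<phi> x)"
  \<comment> \<open>The right-hand side of \<open>i3\<close> below with \<open>W1\<close>,
    \<open>W2\<close>, \<open>W3\<close> replaced by the terms that the cutoff at L produces. It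
    does not involve n.\<close>
  define D where "D = L powr (q - p) * P / (q - p) - p * (L powr (q - 1) * F) / (q - 1)
    + (p - K) * L powr q / q + \<eta> * (v * L powr q - L powr (q - 1) * F)"
  have \<eta>: "0 \<le> \<eta>"
    using Bernoulli_quotient[OF p q] p unfolding \<eta>_def v_def by (intro mult_nonneg_nonneg) auto
  \<comment> \<open>This is the hypothesis on K multiplied by \<open>v powr p\<close>, because q /
    (q - 1) is the inverse of v.\<close>
  have \<delta>: "0 < \<delta>"
  proof -
    have "v powr p * (q / (q - 1)) powr p = 1"
      using p q by (simp add: v_def flip: powr_mult)
    moreover have "v powr p * ((q - p) / q * (q / (q - 1)) powr p * K) < v powr p * 1"
      using K p q by (intro mult_strict_left_mono) (auto simp: v_def)
    ultimately have "(q - p) / q * K < v powr p"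
      by (simp add: algebra_simps)
    then have "(q - p) / q * K / (q - p) < v powr p / (q - p)"
      using q by (intro divide_strict_right_mono) auto
    then show ?thesis
      using q by (simp add: \<delta>_def)
  qed
  have "(\<integral>\<^sup>+x. ennreal (max L (tree_max n ?X x) powr q) \<partial>M) \<le> ennreal (D / \<delta>)" for n
  proof -
    define V where "V = tree_max n ?X"
    \<comment> \<open>N is positive, as \<open>pointwise_bound\<close> requires, and is what the
      layer-cake formula with cutoff L produces.\<close>
    define N where "N x = max L (V x)" for x
    have V [measurable]: "V \<in> borel_measurable M"
      unfolding V_def by (rule tree_max_measurable[OF space_T])
    obtain B0 where "\<forall>x\<in>?X. V x \<le> B0"
      using tree_max_bounded[of ?X n] space_T by (auto simp: V_def)
    then obtain B where B: "\<And>x. x \<in> ?X \<Longrightarrow> V x \<le> B" "L \<le> B"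
      using that[of "max B0 L"] by force
    have pos: "0 < q - p" "0 < q - 1" "0 < q"
      using p q by auto
    note lc1 = layer_cake_powr[OF int_phi_powr _ V B(1) L(1) B(2) pos(1), simplified]
    note lc2 = layer_cake_powr[OF int_phi nonneg V B(1) L(1) B(2) pos(2), simplified]
    note lc3 = layer_cake_powr[of "\<lambda>_. 1", OF _ _ V B(1) L(1) B(2) pos(3), simplified]
    define W1 where "W1 = (LINT x|M. \<phi> x powr p * N x powr (q - p))"
    define W2 where "W2 = (LINT x|M. \<phi> x * N x powr (q - 1))"
    define W3 where "W3 = (LINT x|M. N x powr q)"
    have split: "integrable M (\<lambda>x. w x * N x powr s)"
      "(LINT x|M. w x * (N x powr s - L powr s) / s) =
          ((LINT x|M. w x * N x powr s) - L powr s * (LINT x|M. w x)) / s"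
      if w: "integrable M w" and i: "integrable M (\<lambda>x. w x * (N x powr s - L powr s))" for w s
    proof -
      have "integrable M (\<lambda>x. w x * (N x powr s - L powr s) + L powr s * w x)"
        using w i by (intro Bochner_Integration.integrable_add) auto
      then show int: "integrable M (\<lambda>x. w x * N x powr s)"
        by (simp add: algebra_simps)
      have "(LINT x|M. w x * (N x powr s - L powr s)) = (LINT x|M. w x * N x powr s - L powr s * w x)"
        by (simp add: algebra_simps)
      also have "\<dots> = (LINT x|M. w x * N x powr s) - L powr s * (LINT x|M. w x)"
        using w int by simp
      finally show "(LINT x|M. w x * (N x powr s - L powr s) / s) =
          ((LINT x|M. w x * N x powr s) - L powr s * (LINT x|M. w x)) / s"
        by simp
    qed
    note s1 = split[OF int_phi_powr lc1(1)[folded N_def], folded W1_def P_def]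
    note s2 = split[OF int_phi lc2(1)[folded N_def], folded W2_def F_def]
    have s3: "integrable M (\<lambda>x. N x powr q)"
      "(LINT x|M. (N x powr q - L powr q) / q) = (W3 - L powr q) / q"
      using split[of "\<lambda>_. 1" q] lc3(1) by (simp_all add: N_def W3_def prob_space)
    define S where "S l = {x \<in> ?X. l < V x}" for l
    have S: "S l = level l n ?X" for l
      by (simp add: S_def level_def V_def)
    \<comment> \<open>These are the layer-cake integrands for the exponents q - p, q - 1 and q. With
      these weights both level estimates become linear in \<open>f1\<close>, \<open>f2\<close>,
      \<open>f3\<close>.\<close>
    define f1 where "f1 l = indicator {L..B} l * (l powr (q - p - 1) * (LINT x:S l|M. \<phi> x powr p))" for l :: real
    define f2 where "f2 l = indicator {L..B} l * (l powr (q - 1 - 1) * (LINT x:S l|M. \<phi> x))" for l :: real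
    define f3 where "f3 l = indicator {L..B} l * (l powr (q - 1) * measure M (S l))" for l :: real
    have h1: "has_bochner_integral lborel f1 ((W1 - L powr (q - p) * P) / (q - p))"
      using lc1(2) unfolding f1_def S_def s1(2)[symmetric] N_def by simp
    have h2: "has_bochner_integral lborel f2 ((W2 - L powr (q - 1) * F) / (q - 1))"
      using lc2(2) unfolding f2_def S_def s2(2)[symmetric] N_def by simp
    have h3: "has_bochner_integral lborel f3 ((W3 - L powr q) / q)"
    proof -
      have [measurable]: "S l \<in> sets M" for l unfolding S_def by measurable
      then have "(LINT x:S l|M. 1) = measure M (S l)" for l
        by (simp add: set_lebesgue_integral_def)
      with lc3(2) show ?thesis
        unfolding f3_def s3(2)[symmetric] N_def by (simp flip: S_def)
    qed
    have X: "?X \<in> T" "0 < measure M ?X"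
      using space_T prob_space by auto
    have pw: "f1 l - p * f2 l + (p - K) * f3 l \<le> 0" "f3 l \<le> f2 l" for l
    proof -
      have "f1 l - p * f2 l + (p - K) * f3 l \<le> 0 \<and> f3 l \<le> f2 l"
      proof (cases "l \<in> {L..B}")
        case True
        then have l: "0 < l" "avg ?X \<le> l" using L by auto
        have e: "l powr (q - p - 1) * l powr (p - 1) = l powr (q - 1 - 1)"
          "l powr (q - p - 1) * l powr p = l powr (q - 1)"
          "l powr (q - 1 - 1) * l = l powr (q - 1)"
          using powr_mult_base[of l "q - 1 - 1"] l by (simp_all add: mult.commute flip: powr_add)
        have "l powr (q - p - 1) * ((LINT x:S l|M. \<phi> x powr p) - p * l powr (p - 1) * (LINT x:S l|M. \<phi> x)
            + (p - 1 - real k * (c - 1)) * l powr p * measure M (S l)) \<le> 0"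
          using level_power[OF X l(2,1), of n] by (intro mult_nonneg_nonpos) (auto simp: S)
        also have "l powr (q - p - 1) * ((LINT x:S l|M. \<phi> x powr p) - p * l powr (p - 1) * (LINT x:S l|M. \<phi> x)
            + (p - 1 - real k * (c - 1)) * l powr p * measure M (S l))
          = l powr (q - p - 1) * (LINT x:S l|M. \<phi> x powr p)
            - p * ((l powr (q - p - 1) * l powr (p - 1)) * (LINT x:S l|M. \<phi> x))
            + (p - K) * ((l powr (q - p - 1) * l powr p) * measure M (S l))"
          by (simp add: K_def algebra_simps)
        finally have "f1 l - p * f2 l + (p - K) * f3 l \<le> 0"
          using True unfolding e by (simp add: f1_def f2_def f3_def)
        moreover have "l powr (q - 1 - 1) * (l * measure M (S l)) \<le> l powr (q - 1 - 1) * (LINT x:S l|M. \<phi> x)"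
          using level_mass[OF X] by (intro mult_left_mono) (auto simp: S)
        then have "f3 l \<le> f2 l"
          using True unfolding mult.assoc[symmetric] e(3) by (simp add: f2_def f3_def)
        ultimately show ?thesis by simp
      qed (simp add: f1_def f2_def f3_def)
      then show "f1 l - p * f2 l + (p - K) * f3 l \<le> 0" "f3 l \<le> f2 l" by auto
    qed
    have "has_bochner_integral lborel (\<lambda>l. f1 l - p * f2 l + (p - K) * f3 l)
        ((W1 - L powr (q - p) * P) / (q - p) - p * ((W2 - L powr (q - 1) * F) / (q - 1))
          + (p - K) * ((W3 - L powr q) / q))"
      by (intro has_bochner_integral_add has_bochner_integral_diff has_bochner_integral_mult_right h1 h2 h3)
    moreover have "0 \<le> (LINT l|lborel. - (f1 l - p * f2 l + (p - K) * f3 l))"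
      by (intro Bochner_Integration.integral_nonneg) (simp only: neg_0_le_iff_le pw(1))
    then have "(LINT l|lborel. f1 l - p * f2 l + (p - K) * f3 l) \<le> 0"
      by (simp only: integral_minus neg_0_le_iff_le)
    ultimately have i1: "(W1 - L powr (q - p) * P) / (q - p) - p * ((W2 - L powr (q - 1) * F) / (q - 1))
          + (p - K) * ((W3 - L powr q) / q) \<le> 0"
      by (simp only: has_bochner_integral_integral_eq)
    have i2: "(W3 - L powr q) / q \<le> (W2 - L powr (q - 1) * F) / (q - 1)"
      using integral_mono[of lborel f3 f2] pw(2) h2 h3 by (auto simp: has_bochner_integral_iff)
    have i3: "\<delta> * W3 \<le> W1 / (q - p) - p * W2 / (q - 1) + (p - K) * W3 / q + \<eta> * (v * W3 - W2)"
    proof -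
      have "\<delta> * W3 = (LINT x|M. \<delta> * N x powr q)"
        by (simp add: W3_def)
      also have "\<dots> \<le> (LINT x|M. \<phi> x powr p * N x powr (q - p) / (q - p) - p * (\<phi> x * N x powr (q - 1)) / (q - 1)
          + (p - K) * N x powr q / q + \<eta> * (v * N x powr q - \<phi> x * N x powr (q - 1)))"
      proof (rule integral_mono)
        fix x assume "x \<in> ?X"
        then show "\<delta> * N x powr q \<le> \<phi> x powr p * N x powr (q - p) / (q - p) - p * (\<phi> x * N x powr (q - 1)) / (q - 1)
          + (p - K) * N x powr q / q + \<eta> * (v * N x powr q - \<phi> x * N x powr (q - 1))"
          using pointwise_bound[OF p q nonneg, of x "N x" K] L by (simp add: \<delta>_def \<eta>_def v_def N_def)
      qed (use s1(1) s2(1) s3(1) in auto)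
      also have "\<dots> = W1 / (q - p) - p * W2 / (q - 1) + (p - K) * W3 / q + \<eta> * (v * W3 - W2)"
        using s1(1) s2(1) s3(1) by (simp add: W1_def W2_def W3_def)
      finally show ?thesis .
    qed
    \<comment> \<open>In \<open>i3\<close>, \<open>i1\<close> bounds the first three terms by their
      cutoff counterparts, and \<open>i2\<close> scaled by (q - 1) and \<eta> does so for the
      last.\<close>
    have "\<delta> * W3 \<le> D"
    proof -
      have "(q - 1) * ((W3 - L powr q) / q) \<le> (q - 1) * ((W2 - L powr (q - 1) * F) / (q - 1))"
        using i2 pos by (intro mult_left_mono) auto
      then have "v * (W3 - L powr q) \<le> W2 - L powr (q - 1) * F"
        using pos by (simp add: v_def)
      then have "\<eta> * (v * W3 - W2) \<le> \<eta> * (v * L powr q - L powr (q - 1) * F)"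
        using \<eta> by (intro mult_left_mono) (auto simp: algebra_simps)
      with i1 i3 show ?thesis
        unfolding D_def by (simp add: diff_divide_distrib right_diff_distrib)
    qed
    then have "W3 \<le> D / \<delta>"
      using \<delta> by (simp add: field_simps)
    moreover have "(\<integral>\<^sup>+x. ennreal (N x powr q) \<partial>M) = ennreal W3"
      unfolding W3_def by (rule nn_integral_eq_integral) (use s3 in auto)
    ultimately show ?thesis
      by (simp add: N_def V_def ennreal_leI)
  qed
  then show ?thesis by blast
qed

section \<open>From the maximal function back to \<phi>\<close>

lemma avg_path_le_tree_max:
  assumes "\<And>i. I i \<in> T \<and> x \<in> I i \<and> I (Suc i) \<in> C (I i)"
  shows "avg (I n) \<le> tree_max n (I 0) x"
  using assms
proof (induction n arbitrary: I)
  case (Suc n)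
  have "avg (I (Suc n)) \<le> tree_max n (I 1) x"
    using Suc.IH[of "\<lambda>i. I (Suc i)"] Suc.prems by simp
  also have "\<dots> \<le> tree_max (Suc n) (I 0) x"
    using Suc.prems[of 0] Suc.prems[of 1] by (subst tree_max_child[of _ "I 1"]) auto
  finally show ?case .
qed simp

lemma path_exists:
  assumes "x \<in> space M"
  shows "\<exists>I. I 0 = space M \<and> (\<forall>n. I n \<in> T \<and> x \<in> I n \<and> I (Suc n) \<in> C (I n))"
proof -
  \<comment> \<open>The conditional clause makes dependent choice start at the root.\<close>
  have "\<exists>I. \<forall>n. ((n = 0 \<longrightarrow> I n = space M) \<and> I n \<in> T \<and> x \<in> I n) \<and> I (Suc n) \<in> C (I n)"
  proof (rule dependent_nat_choice)
    show "\<exists>I. (0 = (0::nat) \<longrightarrow> I = space M) \<and> I \<in> T \<and> x \<in> I"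
      using space_T assms by blast
  next
    fix I :: "'a set" and n :: nat
    assume "(n = 0 \<longrightarrow> I = space M) \<and> I \<in> T \<and> x \<in> I"
    then show "\<exists>J. ((Suc n = 0 \<longrightarrow> J = space M) \<and> J \<in> T \<and> x \<in> J) \<and> J \<in> C I"
      using Union_children[of I] child_T[of I] by blast
  qed
  then show ?thesis by blast
qed

text \<open>Along a branch the measures are k^(-n), positive and tending to 0, so the
  differentiation property applies to it. Nonnegativity of the sequence is recorded for the passage
  to powers.\<close>

lemma phi_limit_of_averages:
  assumes "differentiates_L1 M T"
  shows "AE x in M. \<exists>a. a \<longlonglongrightarrow> \<phi> x \<and> (\<forall>n. 0 \<le> a n \<and> a n \<le> tree_max n (space M) x)"
proof -
  have "AE x in M. \<forall>I :: nat \<Rightarrow> 'a set.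
      (\<forall>n. I n \<in> T \<and> x \<in> I n \<and> 0 < measure M (I n)) \<and> (\<lambda>n. measure M (I n)) \<longlonglongrightarrow> 0 \<longrightarrow>
      (\<lambda>n. avg (I n)) \<longlonglongrightarrow> \<phi> x"
    using assms int_phi unfolding differentiates_L1_def avg_def by blast
  then show ?thesis
  proof (rule AE_mp, intro AE_I2 impI)
    fix x assume x: "x \<in> space M" and lim: "\<forall>I :: nat \<Rightarrow> 'a set.
      (\<forall>n. I n \<in> T \<and> x \<in> I n \<and> 0 < measure M (I n)) \<and> (\<lambda>n. measure M (I n)) \<longlonglongrightarrow> 0 \<longrightarrow>
      (\<lambda>n. avg (I n)) \<longlonglongrightarrow> \<phi> x"
    obtain I where I: "I 0 = space M" "\<And>n. I n \<in> T \<and> x \<in> I n \<and> I (Suc n) \<in> C (I n)"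
      using path_exists[OF x] by blast
    have m: "measure M (I n) = (1 / real k) ^ n" for n
    proof (induction n)
      case (Suc n)
      then show ?case
        using measure_child[of "I n" "I (Suc n)"] I(2)[of n] by simp
    qed (simp add: I(1) prob_space)
    have "(\<lambda>n. measure M (I n)) \<longlonglongrightarrow> 0"
      unfolding m using k by (intro LIMSEQ_power_zero) auto
    moreover have "0 < measure M (I n)" for n
      unfolding m using k by simp
    ultimately have "(\<lambda>n. avg (I n)) \<longlonglongrightarrow> \<phi> x"
      using lim I(2) by blast
    moreover have "0 \<le> avg (I n)" "avg (I n) \<le> tree_max n (space M) x" for n
      using avg_nonneg I(2)[of n] avg_path_le_tree_max[of I x n, OF I(2)] I(1) by auto
    ultimately show "\<exists>a. a \<longlonglongrightarrow> \<phi> x \<and> (\<forall>n. 0 \<le> a n \<and> a n \<le> tree_max n (space M) x)"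
      by blast
  qed
qed

text \<open>Fatou's lemma turns the bound uniform in the depth into integrability, since \<phi> is
  almost everywhere a limit of averages dominated by the truncated maximal functions.\<close>

lemma powr_integrable:
  assumes "differentiates_L1 M T"
    and q: "p < q" and K: "(q - p) / q * (q / (q - 1)) powr p * (real k * c - real k + 1) < 1"
  shows "integrable M (\<lambda>x. \<phi> x powr q)"
proof -
  obtain L D where D: "\<And>n. (\<integral>\<^sup>+x. ennreal (max L (tree_max n (space M) x) powr q) \<partial>M) \<le> ennreal D"
    using tree_max_powr_bounded[OF q K] by blast
  have [measurable]: "tree_max n (space M) \<in> borel_measurable M" for n
    by (rule tree_max_measurable[OF space_T])
  have "AE x in M. ennreal (\<phi> x powr q) \<le> liminf (\<lambda>n. ennreal (max L (tree_max n (space M) x) powr q))"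
    using phi_limit_of_averages[OF assms(1)]
  proof (rule AE_mp, intro AE_I2 impI)
    fix x assume "\<exists>a. a \<longlonglongrightarrow> \<phi> x \<and> (\<forall>n. 0 \<le> a n \<and> a n \<le> tree_max n (space M) x)"
    then obtain a where a: "a \<longlonglongrightarrow> \<phi> x" "\<And>n. 0 \<le> a n" "\<And>n. a n \<le> tree_max n (space M) x"
      by blast
    have "(\<lambda>n. ennreal (a n powr q)) \<longlonglongrightarrow> ennreal (\<phi> x powr q)"
      using a p q by (intro tendsto_ennrealI tendsto_powr') auto
    then have "ennreal (\<phi> x powr q) = liminf (\<lambda>n. ennreal (a n powr q))"
      by (intro lim_imp_Liminf[symmetric]) simp
    also have "\<dots> \<le> liminf (\<lambda>n. ennreal (max L (tree_max n (space M) x) powr q))"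
      using a p q
      by (intro Liminf_mono always_eventually allI ennreal_leI powr_mono2) (auto simp: le_max_iff_disj)
    finally show "ennreal (\<phi> x powr q) \<le> liminf (\<lambda>n. ennreal (max L (tree_max n (space M) x) powr q))" .
  qed
  then have "(\<integral>\<^sup>+x. ennreal (\<phi> x powr q) \<partial>M)
      \<le> (\<integral>\<^sup>+x. liminf (\<lambda>n. ennreal (max L (tree_max n (space M) x) powr q)) \<partial>M)"
    by (rule nn_integral_mono_AE)
  also have "\<dots> \<le> liminf (\<lambda>n. \<integral>\<^sup>+x. ennreal (max L (tree_max n (space M) x) powr q) \<partial>M)"
    by (rule nn_integral_liminf) measurable
  also have "\<dots> \<le> liminf (\<lambda>_. ennreal D)"
    using D by (intro Liminf_mono always_eventually allI)
  also have "\<dots> < \<infinity>"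
    by (simp add: Liminf_const)
  finally show ?thesis
    by (intro integrableI_nonneg) auto
qed

end

section \<open>The range of exponents below p0\<close>

theorem corollary1:
  fixes M :: "'a measure" and k :: nat and T :: "'a set set"
    and \<phi> :: "'a \<Rightarrow> real" and p c p0 :: real
  assumes "prob_space M" and "non_atomic M"
    and "k > 1" and "homogeneous_tree k M T"
    and "differentiates_L1 M T"
    and "\<forall>x\<in>space M. 0 \<le> \<phi> x" and "integrable M \<phi>"
    and "p > 1" and "c \<ge> 1"
    and "reverse_Holder_on M T p c \<phi>"
    and "p0 > p"
    and "(p0 - p) / p0 * (p0 / (p0 - 1)) powr p * (real k * c - real k + 1) = 1"
  shows "\<forall>q\<in>{p..<p0}. \<phi> \<in> Lp_space q M"
proof
  fix q assume q: "q \<in> {p..<p0}"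
  interpret prob_space M by fact
  have tree: "T \<subseteq> sets M" "space M \<in> T"
    "\<And>I. I \<in> T \<Longrightarrow> \<exists>C\<subseteq>T. card C = k \<and> (\<forall>J\<in>C. J \<subseteq> I) \<and> disjoint C \<and>
        \<Union>C = I \<and> (\<forall>J\<in>C. measure M J = 1 / real k * measure M I)"
    using assms(4) by (auto simp: homogeneous_tree_def)
  obtain C where C: "\<And>I. I \<in> T \<Longrightarrow> C I \<subseteq> T \<and> card (C I) = k \<and> (\<forall>J\<in>C I. J \<subseteq> I) \<and>
        disjoint (C I) \<and> \<Union>(C I) = I \<and> (\<forall>J\<in>C I. measure M J = 1 / real k * measure M I)"
    using tree(3) by metis
  interpret reverse_Holder_tree M k T C \<phi> p c
    by unfold_locales (use assms tree(1,2) C in auto)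
  have "integrable M (\<lambda>x. \<phi> x powr q)"
  \<comment> \<open>The maximal function estimates divide by q - p; at the endpoint
    \<open>q = p\<close> the reverse Holder inequality on the whole space suffices.\<close>
  proof (cases "q = p")
    case False
    have "0 \<le> real k * (c - 1)"
      using assms by simp
    \<comment> \<open>Positivity of K preserves the strict monotonicity in the exponent, which puts
      the left-hand side below its value 1 at p0.\<close>
    then have "0 < real k * c - real k + 1"
      by (simp add: algebra_simps)
    then have "(q - p) / q * (q / (q - 1)) powr p * (real k * c - real k + 1)
        < (p0 - p) / p0 * (p0 / (p0 - 1)) powr p * (real k * c - real k + 1)"
      using exponent_strict_mono[of p q p0] q assms by (intro mult_strict_right_mono) auto
    with False q assms show ?thesis
      by (intro powr_integrable) auto
  qed (use int_phi_powr in simp)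
  moreover have "integrable M (\<lambda>x. \<bar>\<phi> x\<bar> powr q) \<longleftrightarrow> integrable M (\<lambda>x. \<phi> x powr q)"
    using nonneg by (intro Bochner_Integration.integrable_cong) auto
  ultimately show "\<phi> \<in> Lp_space q M"
    by (simp add: Lp_space_def)
qed

end
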